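(* Let $\prec$ be any strict total order on $\mathbb{Z}$, and let $\mathcal{S}_\prec=\{S_\prec(p,q)\}_{p,q\in\mathbb{Z}^2}$ be the system of digital segments derived from $\prec$ (defined in the context). Then $\mathcal{S}_\prec$ is a consistent digital line segments system (CDS).
   Context: Grid graph on $\mathbb{Z}^2$: two points are adjacent iff they differ by $1$ in exactly one coordinate. Derived system $S_\prec$: for $p=(p_x,p_y)$, $q=(q_x,q_y)$, if $p_x>q_x$ swap $p$ and $q$, so assume $p_x\le q_x$. If $p_y\le q_y$, $S_\prec(p,q)$ is the set of points visited by the following walk: start at $p$ and repeatedly step either up (add $(0,1)$) or right (add $(1,0)$) until reaching $q$; when at a point $(x,y)$, step up if $x+y$ is among the $q_y-p_y$ greatest elements, with respect to $\prec$, of the integer interval $[p_x+p_y,\,q_x+q_y-1]$ (the segment interval), and step right otherwise. If $p_y>q_y$, $S_\prec(p,q)$ is defined as the mirror image, under reflection in the $y$-axis $(x,y)\mapsto(-x,y)$, of $S_\prec((-q_x,q_y),(-p_x,p_y))$. A system $\{S(p,q)\}$ with $\{p,q\}\subseteq S(p,q)\subseteq\mathbb{Z}^2$ is a CDS if: (S1) each $S(p,q)$ is the vertex set of a path from $p$ to $q$ in the grid graph; (S2) $S(p,q)=S(q,p)$; (S3) for every $r\in S(p,q)$, $S(p,r)\subseteq S(p,q)$; (S4) for all $p,q$ there is $r\notin S(p,q)$ with $S(p,q)\subseteq S(p,r)$; (S5) if $p,q$ lie on a common horizontal or vertical line then $S(p,q)$ lies on that line. *)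

theory Defs
  imports Main
begin

text \<open>
  Points of the grid are pairs of integers, and the order is a relation \<open>ord\<close> with
  \<open>(s, t) \<in> ord\<close> meaning that \<open>s\<close> precedes \<open>t\<close>.
\<close>

type_synonym point = "int \<times> int"

definition grid_adj :: "point \<Rightarrow> point \<Rightarrow> bool" where
  "grid_adj u v \<longleftrightarrow>
     (\<bar>fst u - fst v\<bar> = 1 \<and> snd u = snd v) \<or> (fst u = fst v \<and> \<bar>snd u - snd v\<bar> = 1)"

definition grid_path :: "point \<Rightarrow> point list \<Rightarrow> point \<Rightarrow> bool" where
  "grid_path p vs q \<longleftrightarrow>
     vs \<noteq> [] \<and> hd vs = p \<and> last vs = q \<and> distinct vs \<and> successively grid_adj vs"

definition cds :: "(point \<Rightarrow> point \<Rightarrow> point set) \<Rightarrow> bool" where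
  "cds S \<longleftrightarrow>
     (\<forall>p q. {p, q} \<subseteq> S p q) \<and>
     (\<forall>p q. \<exists>vs. grid_path p vs q \<and> S p q = set vs) \<and>
     (\<forall>p q. S p q = S q p) \<and>
     (\<forall>p q. \<forall>r \<in> S p q. S p r \<subseteq> S p q) \<and>
     (\<forall>p q. \<exists>r. r \<notin> S p q \<and> S p q \<subseteq> S p r) \<and>
     (\<forall>p q. snd p = snd q \<longrightarrow> (\<forall>r \<in> S p q. snd r = snd p)) \<and>
     (\<forall>p q. fst p = fst q \<longrightarrow> (\<forall>r \<in> S p q. fst r = fst p))"

text \<open>
  An element is among the \<open>k\<close> greatest elements of \<open>A\<close> if fewer than \<open>k\<close> elements of \<open>A\<close>
  lie strictly above it; lemma \<open>greatest_elems_unique\<close> confirms this.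
\<close>

definition greatest_elems :: "'a rel \<Rightarrow> nat \<Rightarrow> 'a set \<Rightarrow> 'a set" where
  "greatest_elems ord k A = {s \<in> A. card {t \<in> A. (s, t) \<in> ord} < k}"

lemma greatest_elems_unique:
  assumes ord: "strict_linear_order ord" and "finite A" "T \<subseteq> A"
    and above: "\<And>s t. s \<in> A - T \<Longrightarrow> t \<in> T \<Longrightarrow> (s, t) \<in> ord"
  shows "greatest_elems ord (card T) A = T"
proof -
  have fin: "finite T" using assms finite_subset by blast
  have irr: "(s, s) \<notin> ord" and tr: "(s, t) \<in> ord \<Longrightarrow> (t, u) \<in> ord \<Longrightarrow> (s, u) \<in> ord" for s t u
    using ord unfolding strict_linear_order_on_def irrefl_def trans_def by blast+
  have "card {t \<in> A. (s, t) \<in> ord} < card T" if "s \<in> T" for s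
  proof (rule psubset_card_mono[OF fin])
    have "{t \<in> A. (s, t) \<in> ord} \<subseteq> T - {s}"
      using above[OF _ that] irr tr by blast
    then show "{t \<in> A. (s, t) \<in> ord} \<subset> T"
      using that by blast
  qed
  moreover have "card T \<le> card {t \<in> A. (s, t) \<in> ord}" if "s \<in> A - T" for s
    using that above assms by (intro card_mono) auto
  ultimately show ?thesis
    using assms(3) unfolding greatest_elems_def by (force simp: not_less[symmetric])
qed

definition segment_interval :: "point \<Rightarrow> point \<Rightarrow> int set" where
  "segment_interval p q = {fst p + snd p .. fst q + snd q - 1}"

definition walk_step :: "int rel \<Rightarrow> point \<Rightarrow> point \<Rightarrow> point \<Rightarrow> point" where
  "walk_step ord p q z =
     (if fst z + snd z \<in> greatest_elems ord (nat (snd q - snd p)) (segment_interval p q)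
      then (fst z, snd z + 1)
      else (fst z + 1, snd z))"

text \<open>Points visited by the walk from \<open>p\<close> until it reaches \<open>q\<close>; used when \<open>q\<close> is weakly
  above and to the right of \<open>p\<close>.\<close>

inductive_set walk :: "int rel \<Rightarrow> point \<Rightarrow> point \<Rightarrow> point set"
  for ord :: "int rel" and p q :: point where
  start: "p \<in> walk ord p q"
| step: "z \<in> walk ord p q \<Longrightarrow> z \<noteq> q \<Longrightarrow> walk_step ord p q z \<in> walk ord p q"

definition mirror :: "point \<Rightarrow> point" where
  "mirror z = (- fst z, snd z)"

definition oriented_segment :: "int rel \<Rightarrow> point \<Rightarrow> point \<Rightarrow> point set" where
  "oriented_segment ord p q =
     (if snd p \<le> snd q then walk ord p q
      else mirror ` walk ord (mirror q) (mirror p))"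

definition derived_segment :: "int rel \<Rightarrow> point \<Rightarrow> point \<Rightarrow> point set" where
  "derived_segment ord p q =
     (if fst p \<le> fst q then oriented_segment ord p q else oriented_segment ord q p)"

end

theory Submission imports Defs begin

text \<open>
  For \<open>p\<close> weakly below and to the left of \<open>q\<close>, the walk is the staircase that moves up exactly
  on the antidiagonals in the top part \<open>T\<close> of the segment interval. A top part intersected with
  a subinterval is a top part of that subinterval, so subsegments of staircases are staircases
  (S3). If \<open>s\<close> is a new antidiagonal at one end of the interval, then \<open>T\<close> or \<open>T \<union> {s}\<close> is a top
  part of the enlarged interval, so segments extend at both ends (S4). The other positions of
  \<open>p\<close> and \<open>q\<close> follow by swapping and reflecting.
\<close>

section \<open>Top parts of sets under a strict order\<close>

definition upper_part :: "'a rel \<Rightarrow> 'a set \<Rightarrow> 'a set \<Rightarrow> bool" where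
  "upper_part ord A T \<longleftrightarrow> T \<subseteq> A \<and> (\<forall>s \<in> A - T. \<forall>t \<in> T. (s, t) \<in> ord)"

text \<open>Links the counting definition used by the walk to \<open>upper_part\<close>, which
  mentions no cardinality and so behaves well when an interval is shrunk or enlarged.\<close>

lemma greatest_elems_upper_part:
  assumes "strict_linear_order ord" "finite A" "upper_part ord A T"
  shows "greatest_elems ord (card T) A = T"
  using assms by (intro greatest_elems_unique) (auto simp: upper_part_def)

lemma upper_part_Int:
  "upper_part ord A T \<Longrightarrow> B \<subseteq> A \<Longrightarrow> upper_part ord B (T \<inter> B)"
  unfolding upper_part_def by blast

lemma finite_strict_linear_order_maximal:
  assumes ord: "strict_linear_order ord" and "finite A" "A \<noteq> {}"
  obtains m where "m \<in> A" "\<And>s. s \<in> A \<Longrightarrow> s \<noteq> m \<Longrightarrow> (s, m) \<in> ord"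
proof -
  have "\<exists>m \<in> A. \<forall>s \<in> A. s \<noteq> m \<longrightarrow> (s, m) \<in> ord"
    using \<open>finite A\<close> \<open>A \<noteq> {}\<close>
  proof (induction rule: finite_ne_induct)
    case (insert x F)
    then obtain m where "m \<in> F" "\<forall>s \<in> F. s \<noteq> m \<longrightarrow> (s, m) \<in> ord" by blast
    moreover have "x = m \<or> (x, m) \<in> ord \<or> (m, x) \<in> ord" "trans ord"
      using ord unfolding strict_linear_order_on_def total_on_def by auto
    ultimately show ?case
      by (metis insert_iff transD)
  qed simp
  then show ?thesis using that by blast
qed

text \<open>Induction on \<open>k\<close>: moving the greatest element of \<open>A - T\<close> into
  \<open>T\<close> yields a top part with one more element.\<close>

lemma upper_part_exists:
  assumes ord: "strict_linear_order ord" and "finite A" "k \<le> card A"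
  obtains T where "upper_part ord A T" "card T = k"
proof -
  have "\<exists>T. upper_part ord A T \<and> card T = k"
    using \<open>k \<le> card A\<close>
  proof (induction k)
    case 0
    then show ?case by (intro exI[of _ "{}"]) (auto simp: upper_part_def)
  next
    case (Suc k)
    then obtain T where T: "upper_part ord A T" "card T = k" by auto
    then have "finite T" "T \<subseteq> A" using \<open>finite A\<close> finite_subset by (auto simp: upper_part_def)
    then have "A - T \<noteq> {}" using T Suc.prems by auto
    then obtain m where m: "m \<in> A - T" "\<And>s. s \<in> A - T \<Longrightarrow> s \<noteq> m \<Longrightarrow> (s, m) \<in> ord"
      using finite_strict_linear_order_maximal[OF ord, of "A - T"] \<open>finite A\<close> by blast
    then have "upper_part ord A (insert m T)" "card (insert m T) = Suc k"
      using T \<open>finite T\<close> by (auto simp: upper_part_def)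
    then show ?case by blast
  qed
  then show ?thesis using that by blast
qed

text \<open>If \<open>s\<close> precedes all of \<open>T\<close>, then \<open>T\<close> stays a top
  part. Otherwise some \<open>t\<close> in \<open>T\<close> precedes \<open>s\<close>; everything in
  \<open>A - T\<close> precedes \<open>t\<close>, hence also \<open>s\<close>, and \<open>s\<close>
  can join \<open>T\<close>.\<close>

lemma upper_part_insert_cases:
  assumes ord: "strict_linear_order ord" and T: "upper_part ord A T" and "s \<notin> A"
  shows "upper_part ord (insert s A) T \<or> upper_part ord (insert s A) (insert s T)"
proof (cases "\<forall>t \<in> T. (s, t) \<in> ord")
  case True
  then show ?thesis using T by (auto simp: upper_part_def)
next
  case False
  then obtain t where "t \<in> T" "(s, t) \<notin> ord" by blast
  moreover have "t \<noteq> s" using T \<open>t \<in> T\<close> \<open>s \<notin> A\<close> by (auto simp: upper_part_def)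
  moreover have tr: "trans ord" using ord by (simp add: strict_linear_order_on_def)
  ultimately have "(t, s) \<in> ord"
    using ord by (auto simp: strict_linear_order_on_def total_on_def)
  then have "(u, s) \<in> ord" if "u \<in> A - T" for u
    using that T \<open>t \<in> T\<close> tr by (meson transD upper_part_def)
  then show ?thesis using T by (auto simp: upper_part_def)
qed

section \<open>Antidiagonals and staircases\<close>

definition below :: "point \<Rightarrow> point \<Rightarrow> bool" where
  "below p q \<longleftrightarrow> fst p \<le> fst q \<and> snd p \<le> snd q"

text \<open>Both kinds of step raise this value by one, so it serves as the time parameter of a
  walk.\<close>

definition level :: "point \<Rightarrow> int" where
  "level z = fst z + snd z"

text \<open>The point on antidiagonal \<open>i\<close> of the staircase that starts at height \<open>y\<close> and moves up
  on the antidiagonals in \<open>T\<close>.\<close>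

definition stair :: "int set \<Rightarrow> int \<Rightarrow> int \<Rightarrow> point" where
  "stair T y i = (let h = y + int (card (T \<inter> {..<i})) in (i - h, h))"

lemma segment_interval_level: "segment_interval p q = {level p ..< level q}"
  by (auto simp: segment_interval_def level_def)

lemma level_stair [simp]: "level (stair T y i) = i"
  by (simp add: level_def stair_def Let_def)

lemma snd_stair: "snd (stair T y i) = y + int (card (T \<inter> {..<i}))"
  by (simp add: stair_def Let_def)

lemma point_eqI: "level u = level v \<Longrightarrow> snd u = snd v \<Longrightarrow> u = v"
  by (simp add: level_def prod_eq_iff)

lemma stair_start:
  assumes "T \<subseteq> {level p ..< b}"
  shows "stair T (snd p) (level p) = p"
proof -
  have "T \<inter> {..<level p} = {}" using assms by auto
  then show ?thesis by (intro point_eqI) (auto simp: snd_stair)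
qed

lemma stair_end:
  assumes "T \<subseteq> {a ..< level q}" "int (card T) = snd q - y"
  shows "stair T y (level q) = q"
proof -
  have "T \<inter> {..<level q} = T" using assms by auto
  then show ?thesis using assms by (intro point_eqI) (auto simp: snd_stair)
qed

lemma snd_stair_diff:
  assumes "finite T" "i \<le> j"
  shows "snd (stair T y j) = snd (stair T y i) + int (card (T \<inter> {i..<j}))"
proof -
  have "T \<inter> {..<j} = (T \<inter> {..<i}) \<union> (T \<inter> {i..<j})" using assms by auto
  moreover have "card ((T \<inter> {..<i}) \<union> (T \<inter> {i..<j})) = card (T \<inter> {..<i}) + card (T \<inter> {i..<j})"
    using assms by (intro card_Un_disjoint) auto
  ultimately show ?thesis by (simp add: snd_stair)
qed

lemma stair_mono:
  assumes "finite T" "i \<le> j"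
  shows "below (stair T y i) (stair T y j)"
proof -
  \<comment> \<open>At most one up move per antidiagonal: the height grows no faster than the level,
    so the first coordinate cannot decrease.\<close>
  have "card (T \<inter> {i..<j}) \<le> card {i..<j}" by (intro card_mono) auto
  then have "int (card (T \<inter> {i..<j})) \<le> j - i" using assms by simp
  then show ?thesis
    using snd_stair_diff[OF assms, of y] level_stair[of T y i] level_stair[of T y j]
    by (auto simp: below_def level_def)
qed

lemma stair_Suc:
  assumes "finite T"
  shows "stair T y (i + 1) = (if i \<in> T then (fst (stair T y i), snd (stair T y i) + 1)
                              else (fst (stair T y i) + 1, snd (stair T y i)))"
proof -
  have "{i..<i + 1} = {i}" by auto
  then have "snd (stair T y (i + 1)) = snd (stair T y i) + (if i \<in> T then 1 else 0)"
    using snd_stair_diff[OF assms, of i "i + 1" y] by simp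
  moreover have "level (stair T y (i + 1)) = level (stair T y i) + 1" by simp
  ultimately show ?thesis
    by (auto simp: level_def prod_eq_iff simp del: level_stair)
qed

text \<open>The size of \<open>T\<close> is the number of up steps, so \<open>T\<close> is exactly
  the set of antidiagonals on which the walk steps up. The staircase then satisfies the recurrence
  of the walk, starts at \<open>p\<close>, and is at \<open>q\<close> on the last level.\<close>

lemma walk_eq_stair:
  assumes ord: "strict_linear_order ord"
    and T: "upper_part ord {level p ..< level q} T" "int (card T) = snd q - snd p"
    and le: "level p \<le> level q"
  shows "walk ord p q = stair T (snd p) ` {level p .. level q}"
proof -
  let ?f = "stair T (snd p)"
  have sub: "T \<subseteq> {level p ..< level q}" using T by (simp add: upper_part_def)
  then have fin: "finite T" using finite_subset by blast
  have p: "?f (level p) = p" and q: "?f (level q) = q"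
    using stair_start[OF sub] stair_end[OF sub T(2)] by auto
  have "greatest_elems ord (nat (snd q - snd p)) (segment_interval p q) = T"
    using greatest_elems_upper_part[OF ord _ T(1)] T(2)
    by (simp add: segment_interval_level flip: T(2))
  then have step: "walk_step ord p q (?f i) = ?f (i + 1)" for i
    using stair_Suc[OF fin, of "snd p" i] level_stair[of T "snd p" i]
    by (auto simp: walk_step_def level_def)
  have "z \<in> ?f ` {level p .. level q}" if "z \<in> walk ord p q" for z
    using that
  proof induction
    case start
    show ?case using p le by (intro rev_image_eqI[of "level p"]) auto
  next
    case (step z)
    then obtain i where i: "z = ?f i" "i \<in> {level p .. level q}" by blast
    \<comment> \<open>The walk moves on only from points other than \<open>q\<close>, so the next
      level is still in range.\<close>
    with step.hyps q have "i \<noteq> level q" by auto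
    then show ?case using i \<open>\<And>i. walk_step ord p q (?f i) = ?f (i + 1)\<close>
      by (intro rev_image_eqI[of "i + 1"]) auto
  qed
  moreover have "?f i \<in> walk ord p q" if "level p \<le> i" "i \<le> level q" for i
    using that
  proof (induction i rule: int_ge_induct)
    case base
    show ?case using p walk.start[of p ord q] by simp
  next
    case (step i)
    then have "?f i \<noteq> q" using level_stair[of T "snd p" i] by auto
    then show ?case using walk.step[of "?f i" ord p q] step \<open>\<And>i. walk_step ord p q (?f i) = ?f (i + 1)\<close>
      by simp
  qed
  ultimately show ?thesis by auto
qed

lemma below_level: "below p q \<Longrightarrow> level p \<le> level q"
  by (simp add: below_def level_def)

section \<open>Reflection and grid paths\<close>

lemma mirror_mirror [simp]: "mirror (mirror z) = z"
  by (simp add: mirror_def)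

lemma mirror_image_mirror [simp]: "mirror ` mirror ` A = A"
  by (simp add: image_image)

lemma mirror_eq_iff [simp]: "mirror u = mirror v \<longleftrightarrow> u = v"
  by (auto simp: mirror_def prod_eq_iff)

lemma snd_mirror [simp]: "snd (mirror z) = snd z"
  and fst_mirror [simp]: "fst (mirror z) = - fst z"
  by (simp_all add: mirror_def)

lemma grid_path_rev:
  assumes "grid_path p vs q"
  shows "grid_path q (rev vs) p"
proof -
  have "successively (\<lambda>x y. grid_adj y x) vs"
    using assms by (auto simp: grid_path_def grid_adj_def abs_minus_commute elim!: successively_mono)
  then show ?thesis using assms
    by (auto simp: grid_path_def hd_rev last_rev)
qed

lemma grid_path_mirror:
  assumes "grid_path p vs q"
  shows "grid_path (mirror p) (map mirror vs) (mirror q)"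
proof -
  have "grid_adj (mirror u) (mirror v) = grid_adj u v" for u v
    by (auto simp: grid_adj_def)
  then show ?thesis using assms
    by (auto simp: grid_path_def hd_map last_map successively_map distinct_map inj_on_def)
qed

lemma grid_path_stair:
  assumes "finite T" "a \<le> b"
  shows "grid_path (stair T y a) (map (stair T y) [a..b]) (stair T y b)"
proof -
  have ne: "[a..b] \<noteq> []" using assms by simp
  have "last [a..b] = b" using upto_rec2[of a b] assms by simp
  moreover have "hd [a..b] = a" using upto_rec1[of a b] assms by simp
  \<comment> \<open>\<open>level\<close> is a left inverse of the staircase, so no point is visited
    twice.\<close>
  moreover have "inj (stair T y)" by (metis injI level_stair)
  moreover have "grid_adj (stair T y i) (stair T y (i + 1))" for i
    using stair_Suc[OF \<open>finite T\<close>, of y i] by (auto simp: grid_adj_def)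
  then have "successively (\<lambda>i j. grid_adj (stair T y i) (stair T y j)) [a..b]"
    by (auto simp: successively_conv_nth nth_upto add.assoc[symmetric] add.commute[of 1])
  ultimately show ?thesis
    using ne by (auto simp: grid_path_def hd_map last_map successively_map distinct_map inj_on_def)
qed

section \<open>Walks between comparable points\<close>

context
  fixes ord :: "int rel"
  assumes ord: "strict_linear_order ord"
begin

lemma walk_stairE:
  assumes "below p q"
  obtains T where "finite T" "upper_part ord {level p ..< level q} T"
    "int (card T) = snd q - snd p" "stair T (snd p) (level p) = p" "stair T (snd p) (level q) = q"
    "walk ord p q = stair T (snd p) ` {level p .. level q}"
proof -
  \<comment> \<open>Since \<open>fst p \<le> fst q\<close>, there are at most as many up moves as
    moves altogether; hence a top part of the required size exists.\<close>
  have "nat (snd q - snd p) \<le> card {level p ..< level q}"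
    using assms by (auto simp: below_def level_def)
  then obtain T where T: "upper_part ord {level p ..< level q} T" "card T = nat (snd q - snd p)"
    using upper_part_exists[OF ord finite_atLeastLessThan_int] by metis
  then have c: "int (card T) = snd q - snd p" using assms by (simp add: below_def)
  have sub: "T \<subseteq> {level p ..< level q}" using T by (simp add: upper_part_def)
  show thesis
    using that[OF finite_subset[OF sub] T(1) c stair_start[OF sub] stair_end[OF sub c]
      walk_eq_stair[OF ord T(1) c below_level[OF assms]]] by simp
qed

lemma walk_between:
  assumes "below p q" "z \<in> walk ord p q"
  shows "below p z" "below z q"
proof -
  obtain T where T: "finite T" "stair T (snd p) (level p) = p" "stair T (snd p) (level q) = q"
    and "walk ord p q = stair T (snd p) ` {level p .. level q}"
    using assms(1) by (rule walk_stairE)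
  with assms obtain i where "z = stair T (snd p) i" "level p \<le> i" "i \<le> level q" by auto
  with stair_mono[OF T(1), of "level p" i "snd p"] stair_mono[OF T(1), of i "level q" "snd p"] T
  show "below p z" "below z q" by auto
qed

lemma walk_path:
  assumes "below p q"
  shows "\<exists>vs. grid_path p vs q \<and> walk ord p q = set vs"
  using assms
proof (rule walk_stairE)
  fix T
  assume T: "finite T" "stair T (snd p) (level p) = p" "stair T (snd p) (level q) = q"
    and "walk ord p q = stair T (snd p) ` {level p .. level q}"
  then show ?thesis
    using grid_path_stair[OF T(1) below_level[OF assms], of "snd p"] by fastforce
qed

text \<open>The up moves of the long walk between the levels of \<open>u\<close> and
  \<open>v\<close> form a top part of the shorter interval, of size \<open>snd v - snd u\<close>.
  They are therefore the up moves of the walk from \<open>u\<close> to \<open>v\<close>. Both ends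
  are left free because S3 needs \<open>u = p\<close> in one orientation and \<open>v = q\<close> in
  the other.\<close>

lemma walk_subsegment:
  assumes "below p q" "u \<in> walk ord p q" "v \<in> walk ord p q" "below u v"
  shows "walk ord u v \<subseteq> walk ord p q"
  using assms(1)
proof (rule walk_stairE)
  fix T
  assume fin: "finite T" and T: "upper_part ord {level p ..< level q} T"
    and w: "walk ord p q = stair T (snd p) ` {level p .. level q}"
  obtain i j where ij: "u = stair T (snd p) i" "v = stair T (snd p) j"
    "level p \<le> i" "j \<le> level q"
    using assms(2,3) w by auto
  have le: "i \<le> j" using below_level[OF assms(4)] ij by simp
  let ?T = "T \<inter> {i..<j}"
  have "upper_part ord {level u ..< level v} ?T"
    using upper_part_Int[OF T, of "{i..<j}"] ij by auto
  moreover have "int (card ?T) = snd v - snd u"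
    using snd_stair_diff[OF fin le, of "snd p"] ij by simp
  ultimately have "walk ord u v = stair ?T (snd u) ` {i..j}"
    using walk_eq_stair[OF ord _ _ below_level[OF assms(4)]] ij by simp
  moreover have "stair ?T (snd u) k = stair T (snd p) k" if "k \<in> {i..j}" for k
  proof (rule point_eqI)
    \<comment> \<open>The up moves before level \<open>i\<close> are missing from \<open>?T\<close>;
      the starting height \<open>snd u\<close> accounts for them.\<close>
    have "?T \<inter> {..<k} = T \<inter> {i..<k}" using that by auto
    then show "snd (stair ?T (snd u) k) = snd (stair T (snd p) k)"
      using snd_stair_diff[OF fin, of i k "snd p"] that ij(1) by (simp add: snd_stair)
  qed simp
  ultimately show ?thesis using ij w by auto
qed

text \<open>The enlarged interval has \<open>T\<close> or \<open>insert s T\<close> as a top part.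
  Accordingly \<open>r\<close> is the right or the upper neighbour of \<open>q\<close>, so that the
  additional move from \<open>q\<close> is the one the order prescribes.\<close>

lemma walk_extend_end:
  assumes "below p q"
  obtains r where "below q r" "level r = level q + 1" "q \<in> walk ord p r"
  using assms
proof (rule walk_stairE)
  fix T
  assume fin: "finite T" and T: "upper_part ord {level p ..< level q} T"
    and c: "int (card T) = snd q - snd p" and e: "stair T (snd p) (level q) = q"
  note extension = that
  \<comment> \<open>The segment interval stops at \<open>level q - 1\<close>, so this is the first
    antidiagonal after it.\<close>
  define s where "s = level q"
  have le: "level p \<le> s" using below_level[OF assms] by (simp add: s_def)
  have sT: "s \<notin> T" using T by (auto simp: upper_part_def s_def)
  have I: "insert s {level p ..< level q} = {level p ..< s + 1}" using le by (auto simp: s_def)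
  \<comment> \<open>The last condition preserves all moves before antidiagonal \<open>s\<close>, so
    the walk to \<open>r\<close> still passes through \<open>q\<close>.\<close>
  have *: thesis if r: "below q r" "level r = s + 1"
    and U: "upper_part ord {level p ..< s + 1} U" "int (card U) = snd r - snd p"
      "U \<inter> {..<s} = T \<inter> {..<s}" for r U
  proof (rule extension[of r])
    have "stair U (snd p) s = stair T (snd p) s"
      using U by (intro point_eqI) (auto simp: snd_stair)
    then show "q \<in> walk ord p r"
      using walk_eq_stair[OF ord, of p r U] U r e le
      by (auto intro!: rev_image_eqI[of s] simp: s_def)
  qed (use r s_def in auto)
  have "s \<notin> {level p ..< level q}" by (simp add: s_def)
  from upper_part_insert_cases[OF ord T this] show thesis
  proof
    assume "upper_part ord (insert s {level p ..< level q}) T"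
    then show thesis using c I
      by (intro *[of "(fst q + 1, snd q)" T]) (auto simp: below_def level_def s_def)
  next
    assume "upper_part ord (insert s {level p ..< level q}) (insert s T)"
    then show thesis using c I sT fin
      by (intro *[of "(fst q, snd q + 1)" "insert s T"]) (auto simp: below_def level_def s_def)
  qed
qed

text \<open>Now the antidiagonal just before \<open>p\<close> is added. If it joins the top part,
  \<open>r\<close> is the lower neighbour of \<open>p\<close>, otherwise the left one.\<close>

lemma walk_extend_start:
  assumes "below p q"
  obtains r where "below r p" "level r = level p - 1" "p \<in> walk ord r q"
  using assms
proof (rule walk_stairE)
  fix T
  assume fin: "finite T" and T: "upper_part ord {level p ..< level q} T"
    and c: "int (card T) = snd q - snd p"
  note extension = that
  define s where "s = level p - 1"
  have le: "s < level q" using below_level[OF assms] by (simp add: s_def)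
  have sT: "s \<notin> T" and T0: "T \<inter> {..<level p} = {}"
    using T by (auto simp: upper_part_def s_def)
  have I: "insert s {level p ..< level q} = {s ..< level q}" using le by (auto simp: s_def)
  \<comment> \<open>Below \<open>level p\<close> the set \<open>U\<close> can contain only
    \<open>s\<close>. The last condition thus says that the single move made there takes
    \<open>r\<close> to the height of \<open>p\<close>.\<close>
  have *: thesis if r: "below r p" "level r = s"
    and U: "upper_part ord {s ..< level q} U" "int (card U) = snd q - snd r"
      "int (card (U \<inter> {..<level p})) = snd p - snd r" for r U
  proof (rule extension[of r])
    have "stair U (snd r) (level p) = p"
      using U by (intro point_eqI) (auto simp: snd_stair)
    then show "p \<in> walk ord r q"
      using walk_eq_stair[OF ord, of r q U] U r le
      by (auto intro!: rev_image_eqI[of "level p"] simp: s_def)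
  qed (use r s_def in auto)
  have "s \<notin> {level p ..< level q}" by (simp add: s_def)
  from upper_part_insert_cases[OF ord T this] show thesis
  proof
    assume "upper_part ord (insert s {level p ..< level q}) T"
    then show thesis using c I T0
      by (intro *[of "(fst p - 1, snd p)" T]) (auto simp: below_def level_def s_def)
  next
    assume "upper_part ord (insert s {level p ..< level q}) (insert s T)"
    moreover have "insert s T \<inter> {..<level p} = {s}" using T0 by (auto simp: s_def)
    ultimately show thesis using c I sT fin
      by (intro *[of "(fst p, snd p - 1)" "insert s T"]) (auto simp: below_def level_def s_def)
  qed
qed

lemma walk_level_point:
  assumes "below p q" "level p \<le> i" "i \<le> level q"
  obtains z where "z \<in> walk ord p q" "level z = i"
  using assms(1)
proof (rule walk_stairE)
  fix T
  assume "walk ord p q = stair T (snd p) ` {level p .. level q}"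
  then show thesis using that[of "stair T (snd p) i"] assms(2,3) by simp
qed

text \<open>For \<open>p\<close> and \<open>q\<close> on a common line, \<open>derived_segment ord p q\<close> and
  \<open>derived_segment ord q p\<close>, or a segment and its mirror image, may come from different
  branches of the definition; they agree because such a walk does not depend on \<open>ord\<close>.\<close>

lemma walk_vertical:
  assumes "fst p = fst q" "snd p \<le> snd q"
  shows "walk ord p q = {fst p} \<times> {snd p .. snd q}"
proof
  have b: "below p q" using assms by (simp add: below_def)
  show "walk ord p q \<subseteq> {fst p} \<times> {snd p .. snd q}"
    using walk_between[OF b] assms by (fastforce simp: below_def)
  show "{fst p} \<times> {snd p .. snd q} \<subseteq> walk ord p q"
  proof (clarify, goal_cases)
    case (1 x y)
    then obtain z where z: "z \<in> walk ord p q" "level z = fst p + y"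
      using walk_level_point[OF b, of "fst p + y"] assms by (auto simp: level_def)
    \<comment> \<open>Lying between \<open>p\<close> and \<open>q\<close> forces \<open>z\<close>
      onto their line; its level then fixes the height.\<close>
    with walk_between[OF b z(1)] assms have "z = (fst p, y)"
      by (auto simp: below_def level_def prod_eq_iff)
    with z show ?case by simp
  qed
qed

lemma walk_horizontal:
  assumes "snd p = snd q" "fst p \<le> fst q"
  shows "walk ord p q = {fst p .. fst q} \<times> {snd p}"
proof
  have b: "below p q" using assms by (simp add: below_def)
  show "walk ord p q \<subseteq> {fst p .. fst q} \<times> {snd p}"
    using walk_between[OF b] assms by (fastforce simp: below_def)
  show "{fst p .. fst q} \<times> {snd p} \<subseteq> walk ord p q"
  proof (clarify, goal_cases)
    case (1 x y)
    then obtain z where z: "z \<in> walk ord p q" "level z = x + snd p"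
      using walk_level_point[OF b, of "x + snd p"] assms by (auto simp: level_def)
    with walk_between[OF b z(1)] assms have "z = (x, snd p)"
      by (auto simp: below_def level_def prod_eq_iff)
    with z show ?case by simp
  qed
qed

lemma mirror_walk_vertical:
  assumes "fst p = fst q" "snd p \<le> snd q"
  shows "mirror ` walk ord (mirror p) (mirror q) = walk ord p q"
  using assms by (auto simp: walk_vertical mirror_def image_iff)

lemma mirror_walk_horizontal:
  assumes "snd p = snd q" "fst p \<le> fst q"
  shows "walk ord (mirror q) (mirror p) = mirror ` walk ord p q"
proof -
  have "(\<exists>x \<in> {fst p .. fst q}. a = - x) \<longleftrightarrow> - fst q \<le> a \<and> a \<le> - fst p" for a
    by (auto intro!: bexI[of _ "- a"])
  then show ?thesis using assms by (auto simp: walk_horizontal mirror_def image_iff)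
qed

section \<open>Derived segments and the CDS conditions\<close>

lemma derived_segment_below:
  assumes "below p q"
  shows "derived_segment ord p q = walk ord p q" "derived_segment ord q p = walk ord p q"
proof -
  show "derived_segment ord p q = walk ord p q"
    using assms by (simp add: derived_segment_def oriented_segment_def below_def)
  show "derived_segment ord q p = walk ord p q"
  \<comment> \<open>With equal first coordinates the definition does not swap \<open>q\<close> and
    \<open>p\<close>, so for distinct points the downward segment comes from the mirrored
    branch.\<close>
  proof (cases "fst p = fst q")
    case True
    show ?thesis
    proof (cases "p = q")
      case False
      then have "snd p < snd q" using True assms by (auto simp: below_def prod_eq_iff)
      then show ?thesis using True mirror_walk_vertical[of p q]
        by (simp add: derived_segment_def oriented_segment_def)
    qed (simp add: derived_segment_def oriented_segment_def)
  next
    case False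
    then show ?thesis
      using assms by (simp add: derived_segment_def oriented_segment_def below_def)
  qed
qed

lemma derived_segment_mirror_below:
  assumes "below p q"
  shows "derived_segment ord (mirror p) (mirror q) = mirror ` walk ord p q"
    and "derived_segment ord (mirror q) (mirror p) = mirror ` walk ord p q"
proof -
  \<comment> \<open>If \<open>snd p < snd q\<close>, the mirrored branch applies and the double
    reflections cancel; on a horizontal line the direct branch applies instead.\<close>
  have o: "oriented_segment ord (mirror q) (mirror p) = mirror ` walk ord p q"
    using assms mirror_walk_horizontal[of p q]
    by (auto simp: oriented_segment_def below_def)
  then show "derived_segment ord (mirror q) (mirror p) = mirror ` walk ord p q"
    using assms by (simp add: derived_segment_def below_def)
  have "walk ord (mirror p) (mirror q) = mirror ` walk ord p q" if "fst p = fst q"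
    using mirror_walk_vertical[of p q] assms that by (metis below_def mirror_image_mirror)
  then show "derived_segment ord (mirror p) (mirror q) = mirror ` walk ord p q"
    using assms o by (auto simp: derived_segment_def oriented_segment_def below_def)
qed

text \<open>Any two points are comparable under \<open>below\<close>, possibly after reflection.
  Swapping is not a closure premise like reflection, since S3 and S4 treat the two endpoints
  differently.\<close>

lemma point_pair_wlog [case_names below above mirror]:
  assumes "\<And>p q. below p q \<Longrightarrow> P p q" "\<And>p q. below p q \<Longrightarrow> P q p"
    and "\<And>p q. P p q \<Longrightarrow> P (mirror p) (mirror q)"
  shows "P p q"
proof -
  have "below p q \<or> below q p \<or> below (mirror p) (mirror q) \<or> below (mirror q) (mirror p)"
    by (auto simp: below_def)
  then show ?thesis using assms by (metis mirror_mirror)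
qed

lemma derived_segment_mirror:
  "derived_segment ord (mirror p) (mirror q) = mirror ` derived_segment ord p q"
  by (induction p q rule: point_pair_wlog)
    (simp_all add: derived_segment_below derived_segment_mirror_below)

lemma derived_segment_commute: "derived_segment ord p q = derived_segment ord q p"
  by (induction p q rule: point_pair_wlog)
    (simp_all add: derived_segment_below derived_segment_mirror)

lemma derived_segment_path: "\<exists>vs. grid_path p vs q \<and> derived_segment ord p q = set vs"
proof (induction p q rule: point_pair_wlog)
  case (below p q)
  then show ?case by (simp add: derived_segment_below walk_path)
next
  case (above p q)
  then show ?case using walk_path[OF above] grid_path_rev
    by (metis derived_segment_below(2) set_rev)
next
  case (mirror p q)
  then show ?case using grid_path_mirror by (metis derived_segment_mirror set_map)
qed

lemma derived_segment_endpoints: "{p, q} \<subseteq> derived_segment ord p q"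
proof -
  obtain vs where "grid_path p vs q" "derived_segment ord p q = set vs"
    using derived_segment_path by blast
  then show ?thesis by (metis empty_subsetI grid_path_def hd_in_set insert_subset last_in_set)
qed

lemma walk_endpoints:
  assumes "below p q"
  shows "p \<in> walk ord p q" "q \<in> walk ord p q"
  using derived_segment_endpoints[of p q] derived_segment_below[OF assms] by simp_all

lemma derived_segment_subsegment:
  "\<forall>r \<in> derived_segment ord p q. derived_segment ord p r \<subseteq> derived_segment ord p q"
proof (induction p q rule: point_pair_wlog)
  case (below p q)
  then show ?case
    using walk_subsegment[OF below walk_endpoints(1)[OF below]] walk_between(1)[OF below]
    by (simp add: derived_segment_below(1))
next
  case (above p q)
  then show ?case
    \<comment> \<open>The segment issues from the upper end \<open>q\<close>, so its subsegment to
      \<open>r\<close> is the walk from \<open>r\<close> to \<open>q\<close>.\<close>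
    using walk_subsegment[OF above _ walk_endpoints(2)[OF above]] walk_between(2)[OF above]
    by (simp add: derived_segment_below(2))
next
  case (mirror p q)
  then show ?case by (auto simp: derived_segment_mirror)
qed

lemma below_trans: "below p q \<Longrightarrow> below q r \<Longrightarrow> below p r"
  by (simp add: below_def)

lemma derived_segment_extend:
  "\<exists>r. r \<notin> derived_segment ord p q \<and> derived_segment ord p q \<subseteq> derived_segment ord p r"
proof (induction p q rule: point_pair_wlog)
  case (below p q)
  obtain r where r: "below q r" "level r = level q + 1" "q \<in> walk ord p r"
    using walk_extend_end[OF below] .
  have b: "below p r" using below_trans[OF below r(1)] .
  have "r \<notin> walk ord p q"
    using walk_between(2)[OF below, of r] below_level[of r q] r(2) by auto
  moreover have "walk ord p q \<subseteq> walk ord p r"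
    using walk_subsegment[OF b walk_endpoints(1)[OF b] r(3) below] .
  ultimately show ?case using derived_segment_below(1)[OF below] derived_segment_below(1)[OF b]
    by blast
next
  case (above p q)
  \<comment> \<open>The far end is now \<open>p\<close>, so the segment is prolonged before the
    start of the walk.\<close>
  obtain r where r: "below r p" "level r = level p - 1" "p \<in> walk ord r q"
    using walk_extend_start[OF above] .
  have b: "below r q" using below_trans[OF r(1) above] .
  \<comment> \<open>Every point of the walk has level at least \<open>level p\<close>, whereas
    \<open>r\<close> lies one antidiagonal lower.\<close>
  have "r \<notin> walk ord p q"
    using walk_between(1)[OF above, of r] below_level[of p r] r(2) by auto
  moreover have "walk ord p q \<subseteq> walk ord r q"
    using walk_subsegment[OF b r(3) walk_endpoints(2)[OF b] above] .
  ultimately show ?case using derived_segment_below(2)[OF above] derived_segment_below(2)[OF b]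
    by blast
next
  case (mirror p q)
  then obtain r where "r \<notin> derived_segment ord p q"
    "derived_segment ord p q \<subseteq> derived_segment ord p r" by blast
  then show ?case
    by (intro exI[of _ "mirror r"]) (auto simp: derived_segment_mirror)
qed

lemma derived_segment_line:
  "\<forall>r \<in> derived_segment ord p q. (snd p = snd q \<longrightarrow> snd r = snd p) \<and> (fst p = fst q \<longrightarrow> fst r = fst p)"
proof (induction p q rule: point_pair_wlog)
  case (below p q)
  then show ?case using walk_between[OF below]
    by (fastforce simp: derived_segment_below below_def)
next
  case (above p q)
  then show ?case using walk_between[OF above]
    by (fastforce simp: derived_segment_below below_def)
next
  case (mirror p q)
  then show ?case by (auto simp: derived_segment_mirror)
qed

end

theorem theorem3:
  fixes ord :: "int rel"
  assumes "strict_linear_order ord"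
  shows "cds (derived_segment ord)"
  unfolding cds_def
proof (intro conjI allI)
  show "derived_segment ord p q = derived_segment ord q p" for p q
    by (rule derived_segment_commute[OF assms])
qed (use derived_segment_endpoints[OF assms] derived_segment_path[OF assms]
      derived_segment_subsegment[OF assms] derived_segment_extend[OF assms]
      derived_segment_line[OF assms] in \<open>simp_all\<close>)

end
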